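(* For $n,i,j\ge 0$ let $g(n;i,j)$ be the number of Gessel walks of length $n$ ending at the point $(i,j)$, and let $$G(t;x,y)=\sum_{n\ge 0}\Bigl(\sum_{i,j\ge 0} g(n;i,j)\,x^i y^j\Bigr)t^n\in\mathbb{Q}[x,y][[t]].$$ Then $G(t;x,y)$ is algebraic, i.e., there exists a nonzero polynomial $P\in\mathbb{Q}[T,t,x,y]$ with $P(G(t;x,y),t,x,y)=0$.
   Context: A Gessel walk of length $n$ is a sequence of $n$ steps in $\mathbb{Z}^2$, each step taken from $\{(-1,0),(-1,-1),(1,1),(1,0)\}$ (i.e., $\leftarrow,\swarrow,\nearrow,\rightarrow$), starting at the origin $(0,0)$ and never leaving the quarter plane $\mathbb{N}^2=\{(i,j): i,j\ge 0\}$. *)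

theory Defs
  imports
    "HOL-Library.Product_Plus"
    "HOL-Computational_Algebra.Polynomial_FPS"
begin

definition gessel_steps :: "(int \<times> int) set" where
  "gessel_steps = {(-1, 0), (-1, -1), (1, 1), (1, 0)}"

definition quarter_plane :: "(int \<times> int) set" where
  "quarter_plane = {(i, j). 0 \<le> i \<and> 0 \<le> j}"

text \<open>A walk is the list of its steps; the points it visits, starting at the origin, are the
  sums of the prefixes of this list.\<close>

definition gessel_walk :: "(int \<times> int) list \<Rightarrow> bool" where
  "gessel_walk w \<longleftrightarrow>
     set w \<subseteq> gessel_steps \<and> (\<forall>k\<le>length w. sum_list (take k w) \<in> quarter_plane)"

definition gessel_count :: "nat \<Rightarrow> nat \<Rightarrow> nat \<Rightarrow> nat" where
  "gessel_count n i j =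
     card {w. gessel_walk w \<and> length w = n \<and> sum_list w = (int i, int j)}"

text \<open>The ring \<open>\<rat>[x,y]\<close> is rendered as \<open>\<rat>[x][y]\<close>, so that \<open>monom (monom c i) j\<close> is
  \<open>c x\<^sup>i y\<^sup>j\<close>. The sum may be cut off at \<open>i, j \<le> n\<close> because a walk of length \<open>n\<close> ends
  at a point with both coordinates at most \<open>n\<close>; the coefficient formula without this
  restriction is lemma \<open>coeff_gessel_gf\<close> below.\<close>

definition gessel_gf :: "rat poly poly fps" where
  "gessel_gf =
     Abs_fps (\<lambda>n. \<Sum>i\<le>n. \<Sum>j\<le>n. monom (monom (of_nat (gessel_count n i j)) i) j)"

lemma gessel_walk_end_le:
  assumes "set w \<subseteq> gessel_steps"
  shows "fst (sum_list w) \<le> int (length w) \<and> snd (sum_list w) \<le> int (length w)"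
  using assms by (induction w) (auto simp: gessel_steps_def)

lemma finite_gessel_walks:
  "finite {w. gessel_walk w \<and> length w = n \<and> sum_list w = p}"
proof (rule finite_subset)
  show "{w. gessel_walk w \<and> length w = n \<and> sum_list w = p}
      \<subseteq> {w. set w \<subseteq> gessel_steps \<and> length w = n}"
    by (auto simp: gessel_walk_def)
  show "finite {w. set w \<subseteq> gessel_steps \<and> length w = n}"
    by (rule finite_lists_length_eq) (simp add: gessel_steps_def)
qed

lemma gessel_count_eq_0:
  assumes "n < i \<or> n < j"
  shows "gessel_count n i j = 0"
proof -
  have "{w. gessel_walk w \<and> length w = n \<and> sum_list w = (int i, int j)} = {}"
    using assms by (auto simp: gessel_walk_def dest!: gessel_walk_end_le)
  then show ?thesis
    unfolding gessel_count_def by (simp only: card.empty)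
qed

lemma coeff_gessel_gf:
  "coeff (coeff (fps_nth gessel_gf n) j) i = of_nat (gessel_count n i j)"
proof -
  have "coeff (coeff (fps_nth gessel_gf n) j) i =
      (\<Sum>i'\<le>n. \<Sum>j'\<le>n. if i' = i then if j' = j then of_nat (gessel_count n i' j') else 0 else 0)"
    by (auto simp: gessel_gf_def coeff_sum intro!: sum.cong)
  also have "\<dots> = (\<Sum>i'\<le>n. if i' = i
      then \<Sum>j'\<le>n. if j' = j then of_nat (gessel_count n i' j') else 0 else 0)"
    by (intro sum.cong) auto
  also have "\<dots> = of_nat (gessel_count n i j)"
    by (auto simp: gessel_count_eq_0)
  finally show ?thesis .
qed

text \<open>Likewise \<open>\<rat>[T,t,x,y]\<close> is rendered as \<open>\<rat>[x][y][t][T]\<close>. Substituting \<open>g\<close>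
  for the outermost variable \<open>T\<close> evaluates \<open>P\<close> in \<open>\<rat>[x,y][[t]]\<close>, into which its
  coefficients, elements of \<open>\<rat>[x,y][t]\<close>, are embedded.\<close>

definition subst_series :: "rat poly poly poly poly \<Rightarrow> rat poly poly fps \<Rightarrow> rat poly poly fps" where
  "subst_series P g = poly (map_poly fps_of_poly P) g"

definition algebraic_series :: "rat poly poly fps \<Rightarrow> bool" where
  "algebraic_series g \<longleftrightarrow> (\<exists>P. P \<noteq> 0 \<and> subst_series P g = 0)"

end

theory Submission imports Defs begin

text \<open>
  The proof uses Tutte invariants. On the kernel curve
  \<open>K = xy - t(1 + y)(x\<^sup>2y + 1) = 0\<close> the product \<open>xy\<close> decouples as \<open>y/(t(1 + y)) - 1/x\<close>, so the
  functional equation says that \<open>W = 1/x + tG(x,0)\<close> agrees there with a series \<open>V\<close> in \<open>y\<close> and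
  \<open>t\<close>. Likewise \<open>I = u(1/t - u)\<close>, where \<open>u = x + 1/x\<close>, agrees with
  \<open>J = y/(t\<^sup>2(1 + y)\<^sup>2) + (1 - y)\<^sup>2/y\<close>. An invariant without poles is constant, which yields series
  \<open>b, c, d\<close> in \<open>t\<close> alone with \<open>W\<^sup>3 + bW\<^sup>2 + (c + I)W + d = 0\<close>, and the same for \<open>V\<close> and
  \<open>J\<close>.

  The rational function \<open>I\<close> is critical at \<open>x = 1\<close> and \<open>x = -1\<close>, and \<open>J\<close> at \<open>y = 1\<close>. There the
  cubic has a double root, hence its discriminant, a cubic polynomial in the value of \<open>I\<close>, has
  three known roots. Comparing coefficients gives three polynomial equations that make
  \<open>b, c, d\<close> algebraic, and with them \<open>W\<close>, \<open>V\<close> and finally \<open>G\<close>.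
\<close>

subsection \<open>Elements stabilising a finitely generated module\<close>


text \<open>Algebraicity over the image of \<open>e\<close> is treated by finitely generated
  modules: the elements that multiply such a module into itself form a ring, which replaces
  resultants for sums and products of algebraic elements.\<close>

locale domain_algebra =
  fixes e :: "'a::idom \<Rightarrow> 'b::comm_ring_1"
  assumes e_add: "e (a + b) = e a + e b"
    and e_mult: "e (a * b) = e a * e b"
    and e_one: "e 1 = 1"
begin

lemma e_zero: "e 0 = 0"
  using e_add[of 0 0] by (metis add_cancel_right_right add.right_neutral)

sublocale module "\<lambda>a b. e a * b"
  by unfold_locales (simp_all add: e_add e_mult e_one algebra_simps)

lemma e_uminus: "e (- a) = - e a"
  using e_add[of a "- a"] by (simp add: e_zero eq_neg_iff_add_eq_0 add.commute)

lemma e_sum: "e (sum f A) = (\<Sum>a\<in>A. e (f a))"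
  by (induction A rule: infinite_finite_induct) (simp_all add: e_zero e_add)

text \<open>Fraction-free Gaussian elimination: generators are removed one at a time by
  cross-multiplying with a pivot, so nothing is divided in the domain.\<close>

lemma span_dependent:
  assumes "finite B" "finite I" "card B < card I" "\<And>i. i \<in> I \<Longrightarrow> v i \<in> span B"
  shows "\<exists>d. (\<exists>i\<in>I. d i \<noteq> 0) \<and> (\<Sum>i\<in>I. e (d i) * v i) = 0"
  using assms
proof (induction B arbitrary: I v rule: finite_induct)
  case empty
  then obtain i where "i \<in> I" by fastforce
  with empty show ?case by (intro exI[of _ "\<lambda>_. 1"]) auto
next
  case (insert b B)
  have "\<exists>k. \<forall>i\<in>I. v i - e (k i) * b \<in> span B"
    using insert.prems(3) unfolding span_insert by (intro bchoice) auto
  then obtain k where k: "\<And>i. i \<in> I \<Longrightarrow> v i - e (k i) * b \<in> span B" by blast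
  show ?case
  proof (cases "\<forall>i\<in>I. k i = 0")
    case True
    then have "v i \<in> span B" if "i \<in> I" for i
      using k[OF that] that by (simp add: e_zero)
    then show ?thesis
      using insert.IH[of I v] insert.prems insert.hyps by auto
  next
    case False
    then obtain p where p: "p \<in> I" "k p \<noteq> 0" by blast
    \<comment> \<open>The component along \<open>b\<close> cancels in this combination.\<close>
    let ?v = "\<lambda>i. e (k p) * v i - e (k i) * v p"
    have "?v i \<in> span B" if "i \<in> I - {p}" for i
    proof -
      have "?v i = e (k p) * (v i - e (k i) * b) - e (k i) * (v p - e (k p) * b)"
        by (simp add: algebra_simps)
      also have "\<dots> \<in> span B"
        using that p k by (intro span_diff span_scale[OF k]) auto
      finally show ?thesis .
    qed
    moreover have "card B < card (I - {p})"
      using insert.prems insert.hyps p by auto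
    ultimately obtain d i0 where d: "i0 \<in> I - {p}" "d i0 \<noteq> 0"
        "(\<Sum>i\<in>I - {p}. e (d i) * ?v i) = 0"
      using insert.IH[of "I - {p}" ?v] insert.prems(1) by blast
    \<comment> \<open>The relation between the \<open>?v i\<close>, rewritten for the
      \<open>v i\<close>: the pivot collects its contributions from all of them, and
      \<open>d i0 * k p\<close> stays nonzero in a domain.\<close>
    let ?d = "\<lambda>i. if i = p then - (\<Sum>i\<in>I - {p}. d i * k i) else d i * k p"
    have "(\<Sum>i\<in>I. e (?d i) * v i)
        = e (?d p) * v p + (\<Sum>i\<in>I - {p}. e (?d i) * v i)"
      using p insert.prems by (simp add: sum.remove)
    also have "\<dots> = (\<Sum>i\<in>I - {p}. e (d i) * ?v i)"
      by (simp add: e_uminus e_sum e_mult sum_subtractf algebra_simps sum_distrib_left)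
    finally have "(\<Sum>i\<in>I. e (?d i) * v i) = 0"
      using d(3) by simp
    moreover have "?d i0 \<noteq> 0"
      using d p by auto
    ultimately show ?thesis
      using d(1) by (intro exI[of _ ?d] conjI bexI[of _ i0]) auto
  qed
qed

text \<open>The multiplier ring of the module \<open>span B\<close>; by linearity it suffices to
  test generators.\<close>

definition stab :: "'b set \<Rightarrow> 'b set" where
  "stab B = {x. \<forall>b\<in>B. x * b \<in> span B}"

lemma stab_mult_span:
  assumes "x \<in> stab B" "v \<in> span B"
  shows "x * v \<in> span B"
  using assms(2)
proof (induction rule: span_induct_alt)
  case base
  show ?case by (simp add: span_zero)
next
  case (step c b u)
  have "x * (e c * b + u) = e c * (x * b) + x * u"
    by (simp add: algebra_simps)
  then show ?case
    using step assms(1) by (auto simp: stab_def intro!: span_add span_scale)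
qed

lemma stab_base: "e a \<in> stab B"
  by (auto simp: stab_def intro: span_scale span_base)

lemma stab_add: "x \<in> stab B \<Longrightarrow> y \<in> stab B \<Longrightarrow> x + y \<in> stab B"
  by (auto simp: stab_def distrib_right intro!: span_add)

lemma stab_mult: "x \<in> stab B \<Longrightarrow> y \<in> stab B \<Longrightarrow> x * y \<in> stab B"
  unfolding stab_def[of B] mem_Collect_eq mult.assoc
  by (blast intro: stab_mult_span[unfolded stab_def mem_Collect_eq])

lemma stab_uminus: "x \<in> stab B \<Longrightarrow> - x \<in> stab B"
  by (auto simp: stab_def intro!: span_neg)

lemma stab_diff: "x \<in> stab B \<Longrightarrow> y \<in> stab B \<Longrightarrow> x - y \<in> stab B"
  by (auto simp: stab_def left_diff_distrib intro!: span_diff)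

lemma stab_zero: "0 \<in> stab B"
  using stab_base[of 0] by (simp add: e_zero)

lemma stab_one: "1 \<in> stab B"
  using stab_base[of 1] by (simp add: e_one)

lemma stab_power: "x \<in> stab B \<Longrightarrow> x ^ n \<in> stab B"
  by (induction n) (simp_all add: stab_one stab_mult)

lemma poly_map_sum_monom:
  "poly (map_poly e (\<Sum>i\<le>n. monom (d i) i)) x = (\<Sum>i\<le>n. e (d i) * x ^ i)"
proof -
  have coeff: "coeff (\<Sum>i\<le>n. monom (d i) i) i = (if i \<le> n then d i else 0)" for i
    by (auto simp: coeff_sum)
  have "degree (map_poly e (\<Sum>i\<le>n. monom (d i) i)) \<le> n"
    by (rule degree_le) (simp add: coeff_map_poly e_zero coeff)
  then have "(\<Sum>i\<le>degree (map_poly e (\<Sum>i\<le>n. monom (d i) i)).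
        coeff (map_poly e (\<Sum>i\<le>n. monom (d i) i)) i * x ^ i)
      = (\<Sum>i\<le>n. coeff (map_poly e (\<Sum>i\<le>n. monom (d i) i)) i * x ^ i)"
    by (intro sum.mono_neutral_left) (auto simp: not_le coeff_eq_0)
  then show ?thesis
    by (simp add: poly_altdef coeff_map_poly e_zero coeff)
qed

text \<open>All powers of \<open>x\<close> lie in \<open>span B\<close>, since \<open>1\<close>
  does, and \<open>card B + 1\<close> of them are linearly dependent.\<close>

lemma stab_algebraic:
  assumes "finite B" "1 \<in> B" "x \<in> stab B"
  shows "\<exists>p. p \<noteq> 0 \<and> poly (map_poly e p) x = 0"
proof -
  have "x ^ i \<in> span B" for i
    using stab_mult_span[OF stab_power[OF assms(3)] span_base[OF assms(2)]] by simp
  then obtain d i0 where d: "i0 \<le> card B" "d i0 \<noteq> 0" "(\<Sum>i\<le>card B. e (d i) * x ^ i) = 0"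
    using span_dependent[OF assms(1), of "{..card B}" "\<lambda>i. x ^ i"] by auto
  have "coeff (\<Sum>i\<le>card B. monom (d i) i) i0 \<noteq> 0"
    using d by (simp add: coeff_sum)
  then have "(\<Sum>i\<le>card B. monom (d i) i) \<noteq> 0"
    by (metis coeff_0)
  then show ?thesis
    using d(3) poly_map_sum_monom by metis
qed

text \<open>Adjoins a root \<open>y\<close> of a monic equation, with \<open>cs\<close> listed from
  the constant term up: the products of \<open>B\<close> with the powers of \<open>y\<close> below
  the degree generate the larger module.\<close>

lemma stab_extend:
  assumes B: "finite B" "1 \<in> B" and "cs \<noteq> []" and cs: "set cs \<subseteq> stab B"
    and y: "y ^ length cs = (\<Sum>k<length cs. cs ! k * y ^ k)"
  shows "\<exists>B'. finite B' \<and> 1 \<in> B' \<and> stab B \<subseteq> stab B' \<and> y \<in> stab B'"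
proof -
  define n where "n = length cs"
  have "0 < n" using \<open>cs \<noteq> []\<close> by (simp add: n_def)
  define B' where "B' = (\<lambda>(b, k). b * y ^ k) ` (B \<times> {..<n})"
  have span: "u * y ^ k \<in> span B'" if "u \<in> span B" "k < n" for u k
    using that(1)
  proof (induction rule: span_induct_alt)
    case base
    show ?case by (simp add: span_zero)
  next
    case (step a b u)
    have "b * y ^ k \<in> span B'"
      using step \<open>k < n\<close> by (intro span_base) (force simp: B'_def)
    with step show ?case
      by (simp add: distrib_right mult.assoc span_add span_scale)
  qed
  have "finite B'" unfolding B'_def using B by simp
  moreover have "1 \<in> B'" unfolding B'_def using B \<open>0 < n\<close> by (force intro: image_eqI[of _ _ "(1, 0)"])
  moreover have "stab B \<subseteq> stab B'"
  proof
    fix x assume "x \<in> stab B"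
    then show "x \<in> stab B'"
      unfolding stab_def[of B'] by (auto simp: B'_def stab_def mult.assoc[symmetric] intro!: span[unfolded B'_def])
  qed
  moreover have "y \<in> stab B'"
    unfolding stab_def
  proof safe
    fix z assume "z \<in> B'"
    then obtain b k where z: "b \<in> B" "k < n" "z = b * y ^ k" by (auto simp: B'_def)
    show "y * z \<in> span B'"
    proof (cases "Suc k = n")
      case False
      then have "b * y ^ Suc k \<in> span B'"
        using z by (intro span span_base) auto
      then show ?thesis by (simp add: z mult_ac)
    next
      case True
      then have "y * z = b * y ^ n" by (auto simp: z mult_ac)
      also have "\<dots> = (\<Sum>k<n. (cs ! k * b) * y ^ k)"
        unfolding n_def y by (simp add: sum_distrib_left mult_ac)
      also have "\<dots> \<in> span B'"
        using z(1) cs by (intro span_sum span) (auto simp: stab_def n_def subset_iff)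
      finally show ?thesis .
    qed
  qed
  ultimately show ?thesis by blast
qed

text \<open>The powers of \<open>a\<close> are absorbed into the coefficients, and the leading one
  survives in a domain. This clears the denominator at the end.\<close>

lemma algebraic_of_scaled:
  assumes "a \<noteq> 0" "p \<noteq> 0" "poly (map_poly e p) (e a * x) = 0"
  shows "\<exists>p. p \<noteq> 0 \<and> poly (map_poly e p) x = 0"
proof (intro exI conjI)
  let ?p = "\<Sum>i\<le>degree p. monom (coeff p i * a ^ i) i"
  have "coeff ?p (degree p) = lead_coeff p * a ^ degree p"
    by (simp add: coeff_sum)
  then show "?p \<noteq> 0"
    using assms by (metis coeff_0 leading_coeff_0_iff mult_eq_0_iff power_not_zero)
  have e_power: "e (a ^ i) = e a ^ i" for i
    by (induction i) (simp_all add: e_one e_mult)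
  have "poly (map_poly e ?p) x = (\<Sum>i\<le>degree p. e (coeff p i) * (e a * x) ^ i)"
    unfolding poly_map_sum_monom by (simp add: e_mult e_power power_mult_distrib mult.assoc)
  also have "\<dots> = poly (map_poly e (\<Sum>i\<le>degree p. monom (coeff p i) i)) (e a * x)"
    by (simp add: poly_map_sum_monom)
  finally show "poly (map_poly e ?p) x = 0"
    using assms(3) by (simp add: poly_as_sum_of_monoms)
qed

end

subsection \<open>Substitutions in power series\<close>


type_synonym series = "rat poly poly fps"

definition cst :: "rat \<Rightarrow> series" where "cst c = fps_const [:[:c:]:]"
definition varx :: series where "varx = fps_const [:[:0, 1:]:]"
definition vary :: series where "vary = fps_const [:0, 1:]"

text \<open>The value is embedded again as a constant in \<open>x\<close>, so that substitution maps
  the ring to itself and independence of \<open>x\<close> can be stated as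
  \<open>subst_x r f = f\<close>.\<close>

definition subst_x :: "rat \<Rightarrow> series \<Rightarrow> series" where
  "subst_x c f = Abs_fps (\<lambda>n. map_poly (\<lambda>p. [:poly p c:]) (fps_nth f n))"

definition subst_y :: "rat \<Rightarrow> series \<Rightarrow> series" where
  "subst_y c f = Abs_fps (\<lambda>n. [:poly (fps_nth f n) [:c:]:])"

lemma cst_simps [simp]: "cst 0 = 0" "cst 1 = 1" "cst (- 1) = - 1"
proof -
  show "cst 0 = 0" "cst 1 = 1" by (simp_all add: cst_def flip: one_pCons)
  have "cst (- 1) = - fps_const 1" unfolding cst_def fps_const_neg by (simp add: one_pCons)
  then show "cst (- 1) = - 1" by simp
qed

lemma cst_mult_numeral: "r * numeral n = 1 \<Longrightarrow> numeral n * cst r = 1"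
  by (simp add: cst_def numeral_fps_const numeral_poly mult.commute flip: one_pCons)

lemma map_poly_eval_add:
  "map_poly (\<lambda>p. [:poly p c:]) (f + g) = map_poly (\<lambda>p. [:poly p c:]) f + map_poly (\<lambda>p. [:poly p c:]) g"
  for c :: "'a::comm_ring_1"
  by (intro poly_eqI) (simp add: coeff_map_poly)

lemma map_poly_eval_sum:
  "map_poly (\<lambda>p. [:poly p c:]) (sum f A) = (\<Sum>a\<in>A. map_poly (\<lambda>p. [:poly p c:]) (f a))"
  for c :: "'a::comm_ring_1"
  by (induction A rule: infinite_finite_induct) (simp_all add: map_poly_eval_add)

lemma map_poly_eval_mult:
  "map_poly (\<lambda>p. [:poly p c:]) (f * g) = map_poly (\<lambda>p. [:poly p c:]) f * map_poly (\<lambda>p. [:poly p c:]) g"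
  for c :: "'a::comm_ring_1"
proof (rule poly_eqI)
  show "coeff (map_poly (\<lambda>p. [:poly p c:]) (f * g)) n
      = coeff (map_poly (\<lambda>p. [:poly p c:]) f * map_poly (\<lambda>p. [:poly p c:]) g) n" for n
    by (simp add: coeff_map_poly coeff_mult poly_sum sum_to_poly mult.commute)
qed

lemma subst_x_add [simp]: "subst_x c (f + g) = subst_x c f + subst_x c g"
  by (simp add: fps_eq_iff subst_x_def map_poly_eval_add)

lemma subst_x_mult [simp]: "subst_x c (f * g) = subst_x c f * subst_x c g"
  by (simp add: fps_eq_iff subst_x_def fps_mult_nth map_poly_eval_sum map_poly_eval_mult)

lemma subst_y_add [simp]: "subst_y c (f + g) = subst_y c f + subst_y c g"
  by (simp add: fps_eq_iff subst_y_def)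

lemma subst_y_mult [simp]: "subst_y c (f * g) = subst_y c f * subst_y c g"
  by (simp add: fps_eq_iff subst_y_def fps_mult_nth poly_sum sum_to_poly mult.commute)

lemma subst_x_cst [simp]: "subst_x c (cst d) = cst d"
  by (simp add: fps_eq_iff subst_x_def cst_def map_poly_pCons)

lemma subst_y_cst [simp]: "subst_y c (cst d) = cst d"
  by (simp add: fps_eq_iff subst_y_def cst_def)

lemma subst_x_varx [simp]: "subst_x c varx = cst c"
  by (simp add: fps_eq_iff subst_x_def cst_def varx_def map_poly_pCons)

lemma subst_x_vary [simp]: "subst_x c vary = vary"
  by (simp add: fps_eq_iff subst_x_def vary_def map_poly_pCons one_pCons)

lemma subst_y_varx [simp]: "subst_y c varx = varx"
  by (simp add: fps_eq_iff subst_y_def varx_def)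

lemma subst_y_vary [simp]: "subst_y c vary = cst c"
  by (simp add: fps_eq_iff subst_y_def cst_def vary_def)

lemma subst_x_fps_X [simp]: "subst_x c fps_X = fps_X"
  by (simp add: fps_eq_iff subst_x_def fps_X_def map_poly_pCons one_pCons)

lemma subst_y_fps_X [simp]: "subst_y c fps_X = fps_X"
  by (simp add: fps_eq_iff subst_y_def fps_X_def one_pCons)

lemma subst_0_1 [simp]: "subst_x c 0 = 0" "subst_x c 1 = 1" "subst_y c 0 = 0" "subst_y c 1 = 1"
  using subst_x_cst[of c 0] subst_x_cst[of c 1] subst_y_cst[of c 0] subst_y_cst[of c 1]
  by simp_all

lemma subst_x_uminus [simp]: "subst_x c (- f) = - subst_x c f"
  using subst_x_add[of c f "- f"] by (simp add: eq_neg_iff_add_eq_0 add.commute del: subst_x_add)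

lemma subst_y_uminus [simp]: "subst_y c (- f) = - subst_y c f"
  using subst_y_add[of c f "- f"] by (simp add: eq_neg_iff_add_eq_0 add.commute del: subst_y_add)

lemma subst_x_diff [simp]: "subst_x c (f - g) = subst_x c f - subst_x c g"
  using subst_x_add[of c f "- g"] by (simp del: subst_x_add)

lemma subst_y_diff [simp]: "subst_y c (f - g) = subst_y c f - subst_y c g"
  using subst_y_add[of c f "- g"] by (simp del: subst_y_add)

lemma subst_x_power [simp]: "subst_x c (f ^ n) = subst_x c f ^ n"
  by (induction n) simp_all

lemma subst_y_power [simp]: "subst_y c (f ^ n) = subst_y c f ^ n"
  by (induction n) simp_all

lemma subst_numeral [simp]: "subst_x c (numeral n) = numeral n" "subst_y c (numeral n) = numeral n"
  by (induction n) (simp_all only: numeral.simps subst_x_add subst_y_add subst_0_1)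

lemma subst_x_subst_x [simp]: "subst_x c (subst_x d f) = subst_x d f"
  by (simp add: fps_eq_iff subst_x_def map_poly_map_poly o_def)

lemma subst_y_subst_y [simp]: "subst_y c (subst_y d f) = subst_y d f"
  by (simp add: fps_eq_iff subst_y_def)

lemma poly_map_poly_eval:
  "[:poly (map_poly (\<lambda>p. [:poly p c:]) f) [:d:]:] = map_poly (\<lambda>p. [:poly p c:]) [:poly f [:d:]:]"
  for c d :: "'a::comm_ring_1"
  by (induction f) (simp_all add: map_poly_pCons)

lemma subst_y_subst_x: "subst_y d (subst_x c f) = subst_x c (subst_y d f)"
  by (simp add: fps_eq_iff subst_x_def subst_y_def poly_map_poly_eval)

lemma fps_const_dvd_iff: "fps_const d dvd f \<longleftrightarrow> (\<forall>n. d dvd fps_nth f n)"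
  for f :: "'a::comm_ring_1 fps"
proof
  assume "\<forall>n. d dvd fps_nth f n"
  then obtain g where "\<And>n. fps_nth f n = d * g n" unfolding dvd_def by metis
  then have "f = fps_const d * Abs_fps g" by (simp add: fps_eq_iff)
  then show "fps_const d dvd f" by simp
qed (auto elim!: dvdE)

text \<open>The factor theorem, applied to every coefficient in \<open>t\<close> and
  \<open>y\<close>.\<close>

lemma varx_minus_dvd:
  assumes "subst_x c f = 0"
  shows "varx - cst c dvd f"
proof -
  have "[:[:- c, 1:]:] dvd fps_nth f n" for n
  proof -
    have "map_poly (\<lambda>p. [:poly p c:]) (fps_nth f n) = 0"
      using arg_cong[OF assms, of "\<lambda>g. fps_nth g n"] by (simp add: subst_x_def)
    then have "poly (coeff (fps_nth f n) j) c = 0" for j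
      using coeff_map_poly[of "\<lambda>p. [:poly p c:]" "fps_nth f n" j] by simp
    then show ?thesis
      by (simp add: const_poly_dvd_iff poly_eq_0_iff_dvd)
  qed
  then show ?thesis
    by (simp add: varx_def cst_def fps_const_dvd_iff)
qed

lemma vary_minus_dvd:
  assumes "subst_y c f = 0"
  shows "vary - cst c dvd f"
proof -
  have "poly (fps_nth f n) [:c:] = 0" for n
    using arg_cong[OF assms, of "\<lambda>g. fps_nth g n"] by (simp add: subst_y_def)
  then have "[:- [:c:], 1:] dvd fps_nth f n" for n
    by (simp only: poly_eq_0_iff_dvd)
  then show ?thesis
    by (simp add: vary_def cst_def fps_const_dvd_iff)
qed

lemma var_nonzero: "varx \<noteq> 0" "vary \<noteq> 0" "varx - cst c \<noteq> 0" "vary - cst c \<noteq> 0"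
  by (simp_all add: varx_def vary_def cst_def)

text \<open>One step of a Taylor expansion at \<open>x = c\<close>. Independence of \<open>y\<close>
  passes to the quotient, because \<open>varx - cst c\<close> is fixed by \<open>subst_y d\<close>
  and can be cancelled.\<close>

lemma subst_x_expand:
  "\<exists>g. f = subst_x c f + (varx - cst c) * g \<and> (\<forall>d. subst_y d f = f \<longrightarrow> subst_y d g = g)"
proof -
  have "varx - cst c dvd f - subst_x c f"
    by (rule varx_minus_dvd) simp
  then obtain g where g: "f - subst_x c f = (varx - cst c) * g" by (elim dvdE)
  moreover have "subst_y d g = g" if "subst_y d f = f" for d
  proof -
    have "(varx - cst c) * subst_y d g = subst_y d (f - subst_x c f)"
      by (simp only: g subst_y_mult subst_y_diff subst_y_varx subst_y_cst)
    also have "\<dots> = f - subst_x c f"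
      by (simp only: subst_y_diff subst_y_subst_x that)
    also have "\<dots> = (varx - cst c) * g"
      by (rule g)
    finally have "(varx - cst c) * subst_y d g = (varx - cst c) * g" .
    then show ?thesis using var_nonzero(3) by (metis mult_left_cancel)
  qed
  ultimately show ?thesis by (metis add.commute diff_add_cancel)
qed

lemma subst_y_expand:
  "\<exists>g. f = subst_y c f + (vary - cst c) * g \<and> (\<forall>d. subst_x d f = f \<longrightarrow> subst_x d g = g)"
proof -
  have "vary - cst c dvd f - subst_y c f"
    by (rule vary_minus_dvd) simp
  then obtain g where g: "f - subst_y c f = (vary - cst c) * g" by (elim dvdE)
  moreover have "subst_x d g = g" if "subst_x d f = f" for d
  proof -
    have "(vary - cst c) * subst_x d g = subst_x d (f - subst_y c f)"
      by (simp only: g subst_x_mult subst_x_diff subst_x_vary subst_x_cst)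
    also have "\<dots> = f - subst_y c f"
      by (simp only: subst_x_diff subst_y_subst_x[symmetric] that)
    also have "\<dots> = (vary - cst c) * g"
      by (rule g)
    finally have "(vary - cst c) * subst_x d g = (vary - cst c) * g" .
    then show ?thesis using var_nonzero(4) by (metis mult_left_cancel)
  qed
  ultimately show ?thesis by (metis add.commute diff_add_cancel)
qed

subsection \<open>The functional equation\<close>

lemma gessel_walk_snoc:
  "gessel_walk (w @ [s]) \<longleftrightarrow>
    gessel_walk w \<and> s \<in> gessel_steps \<and> sum_list w + s \<in> quarter_plane"
proof -
  have "(\<forall>k\<le>Suc (length w). sum_list (take k (w @ [s])) \<in> quarter_plane) \<longleftrightarrow>
    (\<forall>k\<le>length w. sum_list (take k w) \<in> quarter_plane) \<and> sum_list w + s \<in> quarter_plane"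
    by (auto simp: le_Suc_eq)
  then show ?thesis by (auto simp: gessel_walk_def)
qed

definition walks_to :: "nat \<Rightarrow> int \<times> int \<Rightarrow> (int \<times> int) list set" where
  "walks_to n p = {w. gessel_walk w \<and> length w = n \<and> sum_list w = p}"

lemma card_walks_to: "card (walks_to n (int i, int j)) = gessel_count n i j"
  by (simp add: walks_to_def gessel_count_def)

lemma finite_walks_to: "finite (walks_to n p)"
  unfolding walks_to_def by (rule finite_gessel_walks)

lemma gessel_walk_end: "gessel_walk w \<Longrightarrow> sum_list w \<in> quarter_plane"
  unfolding gessel_walk_def by (metis order_refl take_all)

lemma walks_to_outside: "p \<notin> quarter_plane \<Longrightarrow> walks_to n p = {}"
  using gessel_walk_end by (auto simp: walks_to_def)

lemma walks_to_Suc: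
  assumes "p \<in> quarter_plane"
  shows "walks_to (Suc n) p = (\<Union>s\<in>gessel_steps. (\<lambda>w. w @ [s]) ` walks_to n (p - s))"
proof safe
  fix w assume w: "w \<in> walks_to (Suc n) p"
  then have "length w = Suc n" by (simp add: walks_to_def)
  then obtain v s where v: "w = v @ [s]"
    by (auto simp: length_Suc_conv_rev)
  with w have "v \<in> walks_to n (p - s)" "s \<in> gessel_steps"
    by (auto simp: walks_to_def gessel_walk_snoc)
  then show "w \<in> (\<Union>s\<in>gessel_steps. (\<lambda>w. w @ [s]) ` walks_to n (p - s))"
    unfolding v by (intro UN_I[of s] image_eqI[of _ _ v]) simp_all
qed (use assms in \<open>auto simp: walks_to_def gessel_walk_snoc\<close>)

lemma card_walks_to_Suc:
  assumes "p \<in> quarter_plane"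
  shows "card (walks_to (Suc n) p) = (\<Sum>s\<in>gessel_steps. card (walks_to n (p - s)))"
proof -
  have "card (walks_to (Suc n) p) = (\<Sum>s\<in>gessel_steps. card ((\<lambda>w. w @ [s]) ` walks_to n (p - s)))"
    unfolding walks_to_Suc[OF assms]
    by (intro card_UN_disjoint) (auto simp: gessel_steps_def finite_walks_to)
  also have "\<dots> = (\<Sum>s\<in>gessel_steps. card (walks_to n (p - s)))"
    by (intro sum.cong card_image) (auto simp: inj_on_def)
  finally show ?thesis .
qed

lemma gessel_count_0: "gessel_count 0 i j = (if i = 0 \<and> j = 0 then 1 else 0)"
proof -
  have "{w. gessel_walk w \<and> length w = 0 \<and> sum_list w = (int i, int j)}
      = (if i = 0 \<and> j = 0 then {[]} else {})"
    by (auto simp: gessel_walk_def quarter_plane_def zero_prod_def)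
  then show ?thesis by (simp add: gessel_count_def)
qed

text \<open>Walks are sorted by their last step. The guards stand for predecessors outside the
  quarter plane, which truncated subtraction would move back inside.\<close>

lemma gessel_count_Suc:
  "gessel_count (Suc n) i j = gessel_count n (Suc i) j + gessel_count n (Suc i) (Suc j)
    + (if i = 0 \<or> j = 0 then 0 else gessel_count n (i - 1) (j - 1))
    + (if i = 0 then 0 else gessel_count n (i - 1) j)"
proof -
  have out: "card (walks_to n (a, b)) = 0" if "a < 0 \<or> b < 0" for a b
    using that walks_to_outside[of "(a, b)" n] by (auto simp: quarter_plane_def)
  have inside: "card (walks_to n (a, b)) = gessel_count n (nat a) (nat b)" if "0 \<le> a" "0 \<le> b" for a b
    using that card_walks_to[of n "nat a" "nat b"] by simp
  have "(\<Sum>s\<in>gessel_steps. card (walks_to n ((int i, int j) - s)))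
    = card (walks_to n (int i + 1, int j)) + card (walks_to n (int i + 1, int j + 1))
    + card (walks_to n (int i - 1, int j - 1)) + card (walks_to n (int i - 1, int j))"
    by (simp add: gessel_steps_def)
  moreover have "card (walks_to n (int i - 1, int j - 1))
      = (if i = 0 \<or> j = 0 then 0 else gessel_count n (i - 1) (j - 1))"
    by (auto simp: out inside nat_diff_distrib)
  moreover have "card (walks_to n (int i - 1, int j)) = (if i = 0 then 0 else gessel_count n (i - 1) j)"
    by (auto simp: out inside nat_diff_distrib)
  moreover have "card (walks_to n (int i + 1, int j)) = gessel_count n (Suc i) j"
    "card (walks_to n (int i + 1, int j + 1)) = gessel_count n (Suc i) (Suc j)"
    by (simp_all add: inside nat_add_distrib)
  ultimately show ?thesis
    using card_walks_to_Suc[of "(int i, int j)" n] by (simp add: card_walks_to quarter_plane_def)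
qed


section \<open>Comparison of coefficients\<close>

definition cf :: "series \<Rightarrow> nat \<Rightarrow> nat \<Rightarrow> nat \<Rightarrow> rat" where
  "cf f n i j = coeff (coeff (fps_nth f n) j) i"

lemma series_eqI: "(\<And>n i j. cf f n i j = cf g n i j) \<Longrightarrow> f = g"
  by (simp add: fps_eq_iff poly_eq_iff cf_def)

lemma cf_simps:
  "cf (f + g) n i j = cf f n i j + cf g n i j"
  "cf (f - g) n i j = cf f n i j - cf g n i j"
  "cf (varx * f) n i j = (if i = 0 then 0 else cf f n (i - 1) j)"
  "cf (vary * f) n i j = (if j = 0 then 0 else cf f n i (j - 1))"
  "cf vary n i j = (if n = 0 \<and> i = 0 \<and> j = 1 then 1 else 0)"
  "cf (fps_X * f) n i j = (if n = 0 then 0 else cf f (n - 1) i j)"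
  "cf 1 n i j = (if n = 0 \<and> i = 0 \<and> j = 0 then 1 else 0)"
  "cf (subst_x 0 f) n i j = (if i = 0 then cf f n 0 j else 0)"
  "cf (subst_y 0 f) n i j = (if j = 0 then cf f n i 0 else 0)"
  by (auto simp: cf_def varx_def vary_def subst_x_def subst_y_def coeff_pCons coeff_map_poly
        poly_0_coeff_0 fps_one_def split: nat.split)

lemma cf_gessel_gf: "cf gessel_gf n i j = of_nat (gessel_count n i j)"
  by (simp add: cf_def coeff_gessel_gf)

text \<open>The last-step recursion times \<open>xy\<close>, which removes negative exponents. The
  subtracted terms are the steps that leave the quarter plane; the diagonal step at the origin is
  subtracted twice, hence added back once. Products are nested so that \<open>cf_simps\<close> peels
  off one variable at a time.\<close>

lemma gessel_gf_expanded:
  "varx * (vary * gessel_gf) = varx * vary + fps_X * (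
    varx * (varx * (vary * gessel_gf)) + varx * (varx * (vary * (vary * gessel_gf)))
    + gessel_gf + vary * gessel_gf
    - subst_x 0 gessel_gf - vary * subst_x 0 gessel_gf
    - subst_y 0 gessel_gf + subst_x 0 (subst_y 0 gessel_gf))"
proof (rule series_eqI)
  fix n i j
  show "cf (varx * (vary * gessel_gf)) n i j = cf (varx * vary + fps_X * (
      varx * (varx * (vary * gessel_gf)) + varx * (varx * (vary * (vary * gessel_gf)))
      + gessel_gf + vary * gessel_gf
      - subst_x 0 gessel_gf - vary * subst_x 0 gessel_gf
      - subst_y 0 gessel_gf + subst_x 0 (subst_y 0 gessel_gf))) n i j"
  proof (cases n)
    case 0
    then show ?thesis
      by (auto simp: cf_simps cf_gessel_gf gessel_count_0)
  next
    case (Suc m)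
    then show ?thesis
      by (cases i; cases j) (auto simp: cf_simps cf_gessel_gf gessel_count_Suc)
  qed
qed

subsection \<open>The kernel\<close>

text \<open>This is \<open>xy (1 - t S)\<close> for the step polynomial
  \<open>S = 1/x + 1/(xy) + xy + x\<close>.\<close>

definition kernel :: series where
  "kernel = varx * vary - fps_X * (1 + vary) * (varx ^ 2 * vary + 1)"

lemma gessel_functional_equation:
  "kernel * gessel_gf = varx * vary - fps_X * subst_y 0 gessel_gf
    - fps_X * (1 + vary) * subst_x 0 gessel_gf + fps_X * subst_x 0 (subst_y 0 gessel_gf)"
  using gessel_gf_expanded unfolding kernel_def by algebra

lemma nonzero_1_plus_vary: "1 + vary \<noteq> 0"
  using var_nonzero(4)[of "- 1"] by (simp add: add.commute)

lemma subst_kernel [simp]: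
  "subst_x 0 kernel = - fps_X * (1 + vary)" "subst_y 0 kernel = - fps_X"
  by (simp_all add: kernel_def)

text \<open>At \<open>x = 0\<close> the kernel is not a zero divisor, so the cofactor
  \<open>h\<close> must vanish there.\<close>

lemma kernel_cancel_varx:
  assumes "varx * f = kernel * h"
  obtains h' where "f = kernel * h'"
proof -
  have "fps_X * (1 + vary) * subst_x 0 h = 0"
    using arg_cong[OF assms, of "subst_x 0"] by (simp del: mult_eq_0_iff)
  then have "subst_x 0 h = 0"
    using nonzero_1_plus_vary by simp
  then obtain h' where "h = varx * h'"
    using varx_minus_dvd[of 0 h] by (auto elim: dvdE)
  with assms have "varx * f = varx * (kernel * h')" by (simp only: mult_ac)
  then show ?thesis using that var_nonzero(1) by (metis mult_left_cancel)
qed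

lemma kernel_cancel_vary:
  assumes "vary * f = kernel * h"
  obtains h' where "f = kernel * h'"
proof -
  have "fps_X * subst_y 0 h = 0"
    using arg_cong[OF assms, of "subst_y 0"] by (simp del: mult_eq_0_iff)
  then have "subst_y 0 h = 0" by simp
  then obtain h' where "h = vary * h'"
    using vary_minus_dvd[of 0 h] by (auto elim: dvdE)
  with assms have "vary * f = vary * (kernel * h')" by (simp only: mult_ac)
  then show ?thesis using that var_nonzero(2) by (metis mult_left_cancel)
qed

lemma one_plus_vary: "1 + vary = fps_const (1 + [:0, 1:])"
  by (simp only: vary_def fps_const_add fps_const_1_eq_1[symmetric])

lemma kernel_eq:
  "kernel = varx * vary - fps_X * fps_const ((1 + [:0, 1:]) * ([:[:0, 1:]:] ^ 2 * [:0, 1:] + 1))"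
  by (simp only: kernel_def varx_def vary_def fps_const_mult fps_const_power fps_const_add
      fps_const_1_eq_1[symmetric] mult.assoc)

text \<open>An invariant without poles is constant; the factor \<open>varx\<close> before
  \<open>f\<close> makes the constant zero. Setting \<open>x = 0\<close> or \<open>y = 0\<close>
  turns the kernel into a multiple of \<open>t\<close>, so an induction on the power of
  \<open>t\<close> kills \<open>g\<close>, \<open>f\<close> and \<open>h\<close> together.\<close>

lemma kernel_invariant:
  assumes eq: "(1 + vary) ^ 3 * (varx * f) - g = kernel * h"
    and f: "subst_y 0 f = f" and g: "subst_x 0 g = g"
  shows "f = 0" "g = 0"
proof -
  have g_eq: "g = fps_X * ((1 + vary) * subst_x 0 h)"
    using arg_cong[OF eq, of "subst_x 0"] g by (simp add: mult.assoc)
  have f_eq: "varx * f = subst_y 0 g - fps_X * subst_y 0 h"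
    using arg_cong[OF eq, of "subst_y 0"] f by (simp add: algebra_simps)
  have "fps_nth h n = 0 \<and> fps_nth g n = 0 \<and> fps_nth f n = 0" for n
  proof (induction n rule: less_induct)
    case (less n)
    have prev: "fps_nth h (n - 1) = 0" if "n \<noteq> 0" using less that by simp
    \<comment> \<open>Each of these terms carries a factor \<open>t\<close>, so only the preceding
      coefficient of \<open>h\<close> enters, and none at all for \<open>n = 0\<close>.\<close>
    have shift: "fps_nth (fps_X * (fps_const u * subst_x 0 h)) n = 0"
      "fps_nth (fps_X * subst_y 0 h) n = 0" "fps_nth (fps_X * (fps_const u * h)) n = 0" for u
      using prev by (simp_all add: subst_x_def subst_y_def)
    have g_n: "fps_nth g n = 0"
      by (subst g_eq, subst one_plus_vary) (rule shift)
    then have "fps_nth (varx * f) n = 0"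
      unfolding f_eq fps_sub_nth shift by (simp add: subst_y_def)
    then have f_n: "fps_nth f n = 0" by (simp add: varx_def)
    have "fps_nth (kernel * h) n = 0"
    proof -
      have "kernel * h = (1 + vary) ^ 3 * (varx * f) - g" using eq by simp
      also have "(1 + vary) ^ 3 * (varx * f) = fps_const ((1 + [:0, 1:]) ^ 3 * [:[:0, 1:]:]) * f"
        unfolding one_plus_vary varx_def by (simp add: mult.assoc[symmetric] fps_const_power)
      finally show ?thesis using g_n f_n by simp
    qed
    \<comment> \<open>Only the term \<open>xy\<close> of the kernel is free of \<open>t\<close>, so
      it alone meets the coefficient \<open>n\<close> of \<open>h\<close>.\<close>
    then have "fps_nth (varx * (vary * h)) n = 0"
      using shift(3) unfolding kernel_eq by (simp add: left_diff_distrib mult.assoc)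
    then have "fps_nth h n = 0" by (simp add: varx_def vary_def)
    with g_n f_n show ?case by simp
  qed
  then show "f = 0" "g = 0" by (simp_all add: fps_eq_iff)
qed

subsection \<open>Invariants\<close>


definition bottom :: series where "bottom = subst_y 0 gessel_gf"
definition left :: series where "left = subst_x 0 gessel_gf"
definition corner :: series where "corner = subst_x 0 (subst_y 0 gessel_gf)"

lemma subst_bottom [simp]: "subst_y c bottom = bottom" "subst_x 0 bottom = corner"
  by (simp_all add: bottom_def corner_def)

lemma subst_left [simp]: "subst_x c left = left" "subst_y 0 left = corner"
  by (simp_all add: left_def corner_def subst_y_subst_x)

lemma subst_corner [simp]: "subst_x c corner = corner" "subst_y c corner = corner"
  by (simp_all add: corner_def subst_y_subst_x)

lemma kernel_gessel_gf:
  "kernel * gessel_gf = varx * vary - fps_X * bottom - fps_X * (1 + vary) * left + fps_X * corner"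
  by (simp add: gessel_functional_equation bottom_def left_def corner_def)

text \<open>In terms of \<open>W, V, I, J\<close> above, \<open>inv_x = txW\<close>, \<open>inv_y = t(1 + y)V\<close>,
  \<open>rat_x = t\<^sup>2x\<^sup>2I\<close> and \<open>rat_y = t\<^sup>2y(1 + y)\<^sup>2J\<close>; from here on \<open>b\<close>, \<open>c\<close>, \<open>d\<close> are also
  rescaled, by \<open>t\<close>, \<open>t\<^sup>2\<close>, \<open>t\<^sup>3\<close>.\<close>

definition inv_x :: series where
  "inv_x = fps_X * (1 + varx * (fps_X * bottom))"
definition inv_y :: series where
  "inv_y = vary + fps_X * (1 + vary) * (fps_X * corner - fps_X * (1 + vary) * left)"
definition rat_x :: series where
  "rat_x = fps_X * (varx ^ 2 + 1) * (varx - fps_X * (varx ^ 2 + 1))"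
definition rat_y :: series where
  "rat_y = vary ^ 2 + fps_X ^ 2 * (1 - vary ^ 2) ^ 2"

text \<open>The left side is \<open>t x (1 + y) (W - V)\<close>: this is the functional equation
  after decoupling \<open>xy\<close>.\<close>

lemma inv_pair:
  "(1 + vary) * inv_x - varx * inv_y = - kernel * (1 + fps_X * varx * (1 + vary) * gessel_gf)"
  using kernel_gessel_gf unfolding inv_x_def inv_y_def kernel_def by algebra

text \<open>The left side is \<open>t^2 x^2 y (1 + y)^2 (I - J)\<close>.\<close>

lemma rat_pair:
  "vary * (1 + vary) ^ 2 * rat_x - varx ^ 2 * rat_y
    = kernel * (- varx * vary + fps_X * (1 + vary) * (varx ^ 2 + vary))"
  unfolding rat_x_def rat_y_def kernel_def by algebra

text \<open>Meant for \<open>z = 1 + y\<close>, \<open>w = inv_x\<close>, \<open>v = inv_y\<close>,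
  \<open>p = rat_x\<close>, \<open>q = rat_y\<close>: both summands on the right then contain a
  difference that \<open>inv_pair\<close> or \<open>rat_pair\<close> shows to be a multiple of the
  kernel.\<close>

lemma cubic_difference:
  fixes x y z :: "'a::comm_ring_1"
  shows "y * (z ^ 3 * (w ^ 3 + b * x * w ^ 2 + (c * x ^ 2 + p) * w + d * x ^ 3))
      - x ^ 3 * (y * (v ^ 3 + b * z * v ^ 2 + c * z ^ 2 * v + d * z ^ 3) + q * v)
    = (z * w - x * v) * (y * ((z * w) ^ 2 + z * w * (x * v) + (x * v) ^ 2)
        + y * b * x * z * (z * w + x * v) + y * c * x ^ 2 * z ^ 2 + x ^ 2 * q)
      + z * w * (y * z ^ 2 * p - x ^ 2 * q)"
  by (simp add: algebra_simps power2_eq_square power3_eq_cube)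

text \<open>Single factors \<open>y\<close> and \<open>x\<close> are kept in front so that
  \<open>kernel_cancel_vary\<close> and \<open>kernel_cancel_varx\<close> can strip them, leaving
  the shape required by \<open>kernel_invariant\<close>.\<close>

lemma cubic_pair:
  fixes x y z :: "'a::comm_ring_1"
  assumes f: "w ^ 3 + b * x * w ^ 2 + (c * x ^ 2 + p) * w + d * x ^ 3 = x * (x * (x * (x * f)))"
    and v: "v = y * v1" and 1: "z * w - x * v = - k * a" and 2: "y * z ^ 2 * p - x ^ 2 * q = k * m"
  shows "y * (x * (x * (x * (z ^ 3 * (x * f)
      - (v ^ 3 + b * z * v ^ 2 + c * z ^ 2 * v + q * v1 + d * z ^ 3)))))
    = k * (- a * (y * ((z * w) ^ 2 + z * w * (x * v) + (x * v) ^ 2)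
        + y * b * x * z * (z * w + x * v) + y * c * x ^ 2 * z ^ 2 + x ^ 2 * q)
        + z * w * m)"
proof -
  have regroup: "- k * a * M + W * (k * m) = k * (- a * M + W * m)" for M W
    by (simp add: algebra_simps)
  have "y * (x * (x * (x * (z ^ 3 * (x * f)
      - (v ^ 3 + b * z * v ^ 2 + c * z ^ 2 * v + q * v1 + d * z ^ 3)))))
    = y * (z ^ 3 * (x * (x * (x * (x * f)))))
      - x ^ 3 * (y * (v ^ 3 + b * z * v ^ 2 + c * z ^ 2 * v + d * z ^ 3) + q * (y * v1))"
    by (simp add: algebra_simps power3_eq_cube)
  also have "\<dots> = - k * a * (y * ((z * w) ^ 2 + z * w * (x * v) + (x * v) ^ 2)
        + y * b * x * z * (z * w + x * v) + y * c * x ^ 2 * z ^ 2 + x ^ 2 * q) + z * w * (k * m)"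
    unfolding f[symmetric] v[symmetric] cubic_difference 1 2 ..
  also have "\<dots> = k * (- a * (y * ((z * w) ^ 2 + z * w * (x * v) + (x * v) ^ 2)
        + y * b * x * z * (z * w + x * v) + y * c * x ^ 2 * z ^ 2 + x ^ 2 * q) + z * w * m)"
    by (rule regroup)
  finally show ?thesis .
qed

text \<open>At \<open>x = 0\<close> the poles of order three of \<open>W^3\<close> and
  \<open>I W\<close> cancel, and \<open>b\<close>, \<open>c\<close>, \<open>d\<close> remove the
  remaining polar terms and the constant. At \<open>y = 0\<close> the zero of \<open>V\<close>
  absorbs the simple pole of \<open>J\<close>. So both cubics vanish by
  \<open>kernel_invariant\<close>.\<close>

lemma gessel_cubics:
  obtains b c d where
    "\<And>r. subst_x r b = b" "\<And>r. subst_y r b = b"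
    "\<And>r. subst_x r c = c" "\<And>r. subst_y r c = c"
    "\<And>r. subst_x r d = d" "\<And>r. subst_y r d = d"
    "inv_x ^ 3 + b * varx * inv_x ^ 2 + (c * varx ^ 2 + rat_x) * inv_x + d * varx ^ 3 = 0"
    "vary * inv_y ^ 3 + b * (1 + vary) * vary * inv_y ^ 2 + c * (1 + vary) ^ 2 * vary * inv_y
      + rat_y * inv_y + d * vary * (1 + vary) ^ 3 = 0"
proof -
  define t where "t = (fps_X :: series)"
  define x where "x = varx"
  define y where "y = vary"
  \<comment> \<open>\<open>s0\<close>, \<open>s1\<close>, \<open>s2\<close> are the first three
    coefficients in \<open>x\<close> of \<open>t G(x,0)\<close>, and \<open>a3\<close> is the
    tail.\<close>
  define s0 where "s0 = t * corner"
  have bottom: "subst_x 0 (t * bottom) = s0" "subst_y 0 (t * bottom) = t * bottom"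
    by (simp_all add: s0_def t_def)
  obtain a1 where a1': "t * bottom = subst_x 0 (t * bottom) + (x - cst 0) * a1"
      "subst_y 0 (t * bottom) = t * bottom \<Longrightarrow> subst_y 0 a1 = a1"
    unfolding x_def using subst_x_expand by blast
  note a1 = a1'(1)[unfolded bottom(1)] a1'(2)[OF bottom(2)]
  define s1 where "s1 = subst_x 0 a1"
  obtain a2 where a2: "a1 = s1 + (x - cst 0) * a2" "subst_y 0 a1 = a1 \<Longrightarrow> subst_y 0 a2 = a2"
    unfolding x_def s1_def using subst_x_expand by blast
  define s2 where "s2 = subst_x 0 a2"
  obtain a3 where a3: "a2 = s2 + (x - cst 0) * a3"
    unfolding x_def s2_def using subst_x_expand by blast
  have free: "subst_x r s0 = s0" "subst_y r s0 = s0" "subst_x r s1 = s1" "subst_y r s1 = s1"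
    "subst_x r s2 = s2" "subst_y r s2 = s2" for r
  proof -
    show "subst_x r s0 = s0" "subst_y r s0 = s0" by (simp_all add: s0_def t_def)
    show "subst_x r s1 = s1" "subst_x r s2 = s2" by (simp_all add: s1_def s2_def)
    show "subst_y r s1 = s1" "subst_y r s2 = s2"
      unfolding s1_def s2_def subst_y_subst_x
      by (metis a1(2) subst_y_subst_y) (metis a1(2) a2(2) subst_y_subst_y)
  qed
  \<comment> \<open>These choices cancel the coefficients of \<open>x\<close>, \<open>x\<^sup>2\<close> and \<open>x\<^sup>3\<close> in the cubic; the last one
    makes the constant value of the invariant vanish.\<close>
  define b where "b = - (1 + 2 * t * s0)"
  define c where "c = - (3 * t ^ 2 * (s1 + s0 ^ 2) + 2 * b * t * s0 - t ^ 2 * s1 + t * s0 - 2 * t ^ 2)"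
  define d where "d = - (t ^ 3 * (3 * s2 + 6 * s0 * s1 + s0 ^ 3) + b * t ^ 2 * (2 * s1 + s0 ^ 2)
      + c * t * s0 + t * (t * s1 - t ^ 2 * s2 - 2 * t ^ 2 * s0 + t))"
  have b_free: "subst_x r b = b" "subst_y r b = b" for r
    by (simp_all add: b_def t_def free)
  have c_free: "subst_x r c = c" "subst_y r c = c" for r
    by (simp_all add: c_def t_def free b_free)
  have d_free: "subst_x r d = d" "subst_y r d = d" for r
    by (simp_all add: d_def t_def free b_free c_free)

  \<comment> \<open>\<open>u\<close> is \<open>xW\<close> cut off below \<open>x^4\<close>. The
    powers of \<open>u\<close> are expanded modulo \<open>x^4\<close>, with tails \<open>r2\<close>
    and \<open>r3\<close>.\<close>
  define u where "u = 1 + s0 * x + s1 * x ^ 2 + s2 * x ^ 3"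
  define c2 where "c2 = 2 * s1 + s0 ^ 2"
  define c3 where "c3 = 2 * s2 + 2 * s0 * s1"
  define r2 where "r2 = s1 ^ 2 + 2 * s0 * s2 + 2 * s1 * s2 * x + s2 ^ 2 * x ^ 2"
  define r3 where "r3 = u * r2 + s0 * c3 + s1 * c2 + s2 * (2 * s0) + (s1 * c3 + s2 * c2) * x + s2 * c3 * x ^ 2"
  have u2: "u ^ 2 = 1 + 2 * s0 * x + c2 * x ^ 2 + c3 * x ^ 3 + x ^ 4 * r2"
    unfolding u_def c2_def c3_def r2_def by algebra
  have "u ^ 3 = u * u ^ 2" by algebra
  also have "\<dots> = 1 + 3 * s0 * x + 3 * (s1 + s0 ^ 2) * x ^ 2 + (3 * s2 + 6 * s0 * s1 + s0 ^ 3) * x ^ 3 + x ^ 4 * r3"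
    unfolding u2 r3_def unfolding u_def c2_def c3_def by algebra
  finally have u3: "u ^ 3 = 1 + 3 * s0 * x + 3 * (s1 + s0 ^ 2) * x ^ 2 + (3 * s2 + 6 * s0 * s1 + s0 ^ 3) * x ^ 3 + x ^ 4 * r3" .
  define f0 where "f0 = t ^ 3 * r3 + b * t ^ 2 * (c3 + x * r2) + c * t * (s1 + s2 * x)
     + t * (t * s2 - 2 * t ^ 2 * (s1 + s2 * x) + t * (s0 + s1 * x + s2 * x ^ 2) - t ^ 2 * u)"
  have "(t * u) ^ 3 + b * x * (t * u) ^ 2 + (c * x ^ 2 + rat_x) * (t * u) + d * x ^ 3
      = t ^ 3 * u ^ 3 + b * x * t ^ 2 * u ^ 2 + (c * x ^ 2 + rat_x) * t * u + d * x ^ 3"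
    by algebra
  also have "\<dots> = x ^ 4 * f0"
    unfolding u2 u3 f0_def rat_x_def x_def[symmetric] t_def[symmetric]
    unfolding u_def d_def c_def b_def c2_def by algebra
  finally have f0: "(t * u) ^ 3 + b * x * (t * u) ^ 2 + (c * x ^ 2 + rat_x) * (t * u) + d * x ^ 3 = x ^ 4 * f0" .
  define z where "z = t * a3"
  have w: "inv_x = t * u + x ^ 4 * z"
    unfolding inv_x_def x_def[symmetric] t_def[symmetric] a1(1) a2(1) a3 u_def z_def cst_simps by algebra
  define f where "f = f0 + z * (3 * (t * u) ^ 2 + 3 * (t * u) * (x ^ 4 * z) + (x ^ 4 * z) ^ 2
      + b * x * (2 * (t * u) + x ^ 4 * z) + c * x ^ 2 + rat_x)"
  have P: "inv_x ^ 3 + b * x * inv_x ^ 2 + (c * x ^ 2 + rat_x) * inv_x + d * x ^ 3 = x * (x * (x * (x * f)))"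
    using f0 unfolding w f_def by algebra
  have f_free: "subst_y 0 f = f"
  proof -
    have "x * (x * (x * (x * subst_y 0 f))) = subst_y 0 (x * (x * (x * (x * f))))"
      by (simp add: x_def)
    also have "\<dots> = x * (x * (x * (x * f)))"
      unfolding P[symmetric] by (simp add: x_def inv_x_def rat_x_def b_free c_free d_free)
    finally show ?thesis
      using var_nonzero(1) by (simp add: x_def)
  qed
  \<comment> \<open>Since \<open>e\<close> vanishes at \<open>y = 0\<close>, \<open>inv_y\<close> is
    divisible by \<open>y\<close>; \<open>v1\<close> is the quotient.\<close>
  define e where "e = t * corner - t * (1 + y) * left"
  have e: "subst_y 0 e = 0" "subst_x 0 e = e"
    by (simp_all add: e_def t_def y_def)
  obtain v0 where v0': "e = subst_y 0 e + (y - cst 0) * v0" "subst_x 0 e = e \<Longrightarrow> subst_x 0 v0 = v0"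
    unfolding y_def using subst_y_expand by blast
  note v0 = v0'(1)[unfolded e cst_simps diff_zero add_0] v0'(2)[OF e(2)]
  define v1 where "v1 = 1 + t * (1 + y) * v0"
  have v: "inv_y = y * v1"
    unfolding inv_y_def y_def[symmetric] t_def[symmetric] e_def[symmetric] v0(1) v1_def by algebra
  define g where "g = inv_y ^ 3 + b * (1 + y) * inv_y ^ 2 + c * (1 + y) ^ 2 * inv_y + rat_y * v1 + d * (1 + y) ^ 3"
  have g_free: "subst_x 0 g = g"
    by (simp add: g_def inv_y_def rat_y_def v1_def b_free c_free d_free v0 y_def t_def)
  have "\<exists>h. y * (x * (x * (x * ((1 + y) ^ 3 * (x * f) - g)))) = kernel * h"
    unfolding g_def
    by (rule exI, rule cubic_pair[OF _ v inv_pair[folded x_def y_def] rat_pair[folded x_def y_def]])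
       (simp only: P)
  then obtain h where "(1 + y) ^ 3 * (x * f) - g = kernel * h"
    unfolding x_def y_def by (metis kernel_cancel_varx kernel_cancel_vary)
  then have "f = 0" "g = 0"
    using kernel_invariant[of f g h] f_free g_free by (simp_all add: x_def y_def)
  moreover have "vary * inv_y ^ 3 + b * (1 + vary) * vary * inv_y ^ 2 + c * (1 + vary) ^ 2 * vary * inv_y
      + rat_y * inv_y + d * vary * (1 + vary) ^ 3 = vary * g"
    using v unfolding g_def y_def by algebra
  ultimately show ?thesis
    using that[of b c d] P b_free c_free d_free by (simp add: x_def)
qed

subsection \<open>Singular cubics\<close>


lemma fps_X_mult_neq_1: "fps_X * f \<noteq> (1 :: 'a::comm_ring_1 fps)"
proof
  assume "fps_X * f = 1"
  then have "fps_nth (fps_X * f) 0 = 1" by simp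
  then show False by simp
qed

text \<open>\<open>l\<close> is the rescaled \<open>c + I\<close> at \<open>x = r\<close>, and the
  root \<open>a\<close> is \<open>t W\<close> there. Differentiating the cubic at a critical point
  of \<open>I\<close> leaves \<open>W'\<close> times its derivative in \<open>W\<close>; the proof
  does this by dividing by \<open>x - r\<close>.\<close>

lemma x_double_root:
  fixes r :: rat
  assumes r: "r ^ 2 = 1"
    and free: "\<And>s. subst_x s b = b" "\<And>s. subst_x s c = c" "\<And>s. subst_x s d = d"
    and cubic: "inv_x ^ 3 + b * varx * inv_x ^ 2 + (c * varx ^ 2 + rat_x) * inv_x + d * varx ^ 3 = 0"
  defines "l \<equiv> c + 2 * cst r * fps_X - 4 * fps_X ^ 2"
  shows "\<exists>a. a ^ 3 + b * a ^ 2 + l * a + d = 0 \<and> 3 * a ^ 2 + 2 * b * a + l = 0"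
proof -
  define t where "t = (fps_X :: series)"
  define x where "x = varx"
  define e where "e = cst r"
  have e: "e ^ 2 = 1"
    unfolding e_def cst_def by (simp add: power2_eq_square r[unfolded power2_eq_square] flip: one_pCons)
  have subst_x_x: "subst_x r x = e" and subst_x_t: "subst_x r t = t" and subst_x_e: "subst_x r e = e"
    by (simp_all add: x_def t_def e_def)
  define b0 where "b0 = subst_x r bottom"
  have subst_b0: "subst_x r b0 = b0" by (simp add: b0_def)
  obtain b1 where b1: "bottom = b0 + (x - e) * b1"
    unfolding b0_def x_def e_def using subst_x_expand by blast
  define a where "a = t * (e + t * b0)"
  define m where "m = t * (x * (t * b1) - e)"
  define k where "k = t * x - t ^ 2 * (x + e) ^ 2"
  have w: "inv_x = x * a + (x - e) * m"
    unfolding inv_x_def x_def[symmetric] t_def[symmetric] b1 a_def m_def using e by algebra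
  \<comment> \<open>The square of \<open>x - e\<close> expresses that \<open>I\<close> is critical
    at \<open>e\<close>.\<close>
  have p: "c * x ^ 2 + rat_x = x ^ 2 * l + (x - e) ^ 2 * k"
    unfolding rat_x_def x_def[symmetric] t_def[symmetric] e_def[symmetric] l_def k_def using e by algebra
  define F where "F = a ^ 3 + b * a ^ 2 + l * a + d"
  define F' where "F' = 3 * a ^ 2 + 2 * b * a + l"
  define N where "N = m * x ^ 2 * F' + (x - e) * (3 * x * a * m ^ 2 + (x - e) * m ^ 3 + b * x * m ^ 2 + k * inv_x)"
  have eq: "x ^ 3 * F + (x - e) * N = 0"
    using cubic unfolding x_def[symmetric] p unfolding N_def unfolding w F_def F'_def by algebra
  have subst_l: "subst_x r l = l"
    by (simp add: l_def free)
  have subst_a: "subst_x r a = a"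
    by (simp add: a_def subst_x_t subst_x_e subst_b0)
  have subst_F: "subst_x r F = F" "subst_x r F' = F'"
    by (simp_all add: F_def F'_def subst_l subst_a free)
  have "e ^ 3 * F = 0"
    using arg_cong[OF eq, of "subst_x r"] by (simp add: subst_x_x subst_x_e subst_F)
  then have "F = 0" using e by algebra
  moreover have "F' = 0"
  proof -
    have "N = 0"
      using eq \<open>F = 0\<close> var_nonzero(3)[of r] by (simp add: x_def e_def)
    then have "subst_x r N = 0" by simp
    moreover have "subst_x r N = subst_x r m * e ^ 2 * F'"
      by (simp add: N_def subst_x_x subst_x_e subst_F)
    \<comment> \<open>This value is \<open>t r W'(r)\<close>; its lowest term in \<open>t\<close> is
      \<open>- r t\<close>, coming from \<open>1/x\<close> in \<open>W\<close>.\<close>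
    moreover have "subst_x r m \<noteq> 0"
    proof
      assume "subst_x r m = 0"
      then have "t * (e * (t * subst_x r b1) - e) = 0"
        by (simp add: m_def subst_x_x subst_x_e subst_x_t)
      then have "e * (t * subst_x r b1) - e = 0" by (simp add: t_def)
      then have "t * subst_x r b1 = 1" using e by algebra
      then show False unfolding t_def by (rule notE[OF fps_X_mult_neq_1])
    qed
    moreover have "e \<noteq> 0" using e by auto
    ultimately show ?thesis by simp
  qed
  ultimately show ?thesis
    unfolding F_def F'_def by blast
qed

text \<open>The same argument at \<open>y = 1\<close>, where \<open>t^2 J = 1/4\<close> and
  \<open>a\<close> is \<open>t V\<close>. Here \<open>m\<close> has constant term \<open>1/2\<close>
  in \<open>t\<close>, hence is nonzero.\<close>

lemma y_double_root:
  assumes free: "\<And>s. subst_y s b = b" "\<And>s. subst_y s c = c" "\<And>s. subst_y s d = d"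
    and cubic: "vary * inv_y ^ 3 + b * (1 + vary) * vary * inv_y ^ 2 + c * (1 + vary) ^ 2 * vary * inv_y
      + rat_y * inv_y + d * vary * (1 + vary) ^ 3 = 0"
  defines "l \<equiv> c + cst (1 / 4)"
  shows "\<exists>a. a ^ 3 + b * a ^ 2 + l * a + d = 0 \<and> 3 * a ^ 2 + 2 * b * a + l = 0"
proof -
  define t where "t = (fps_X :: series)"
  define y where "y = vary"
  define q where "q = cst (1 / 4)"
  have q: "4 * q = 1"
    unfolding q_def by (rule cst_mult_numeral) simp
  have subst_y_y: "subst_y 1 y = 1" and subst_y_t: "subst_y 1 t = t" and subst_y_q: "subst_y 1 q = q"
    by (simp_all add: y_def t_def q_def)
  define l0 where "l0 = subst_y 1 left"
  have subst_l0: "subst_y 1 l0 = l0" by (simp add: l0_def)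
  obtain l1 where "left = l0 + (y - cst 1) * l1"
    unfolding l0_def y_def using subst_y_expand by blast
  then have l1: "left = l0 + (y - 1) * l1" by simp
  define a where "a = 2 * q + t * (t * corner - 2 * t * l0)"
  define m where "m = 2 * q - t * (t * ((1 + y) * (l0 + (1 + y) * l1)))"
  define k where "k = t ^ 2 * (1 + y) ^ 2 - q * y"
  have v: "inv_y = (1 + y) * a + (y - 1) * m"
    unfolding inv_y_def y_def[symmetric] t_def[symmetric] l1 a_def m_def using q by algebra
  have p: "c * (1 + y) ^ 2 * y + rat_y = y * (1 + y) ^ 2 * l + (y - 1) ^ 2 * k"
    unfolding k_def rat_y_def y_def[symmetric] t_def[symmetric] q_def[symmetric] l_def using q by algebra
  define F where "F = a ^ 3 + b * a ^ 2 + l * a + d"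
  define F' where "F' = 3 * a ^ 2 + 2 * b * a + l"
  define N where "N = m * y * (1 + y) ^ 2 * F'
    + (y - 1) * (y * (3 * (1 + y) * a * m ^ 2 + (y - 1) * m ^ 3) + b * (1 + y) * y * m ^ 2
      + k * inv_y)"
  have "y * inv_y ^ 3 + b * (1 + y) * y * inv_y ^ 2 + (c * (1 + y) ^ 2 * y + rat_y) * inv_y
      + d * y * (1 + y) ^ 3 = 0"
    using cubic unfolding y_def[symmetric] by algebra
  then have eq: "y * (1 + y) ^ 3 * F + (y - 1) * N = 0"
    unfolding p unfolding N_def unfolding v F_def F'_def by algebra
  have subst_l: "subst_y 1 l = l"
    by (simp add: l_def free)
  have subst_a: "subst_y 1 a = a"
    by (simp add: a_def subst_y_t subst_y_q subst_l0)
  have subst_F: "subst_y 1 F = F" "subst_y 1 F' = F'"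
    by (simp_all add: F_def F'_def subst_l subst_a free)
  have "(1 + 1) ^ 3 * F = 0"
    using arg_cong[OF eq, of "subst_y 1"] by (simp add: subst_y_y subst_F)
  then have "F = 0" by simp
  moreover have "F' = 0"
  proof -
    have "y - 1 \<noteq> 0"
      using var_nonzero(4)[of 1] by (simp add: y_def)
    then have "N = 0"
      using eq \<open>F = 0\<close> by simp
    then have "subst_y 1 N = 0" by simp
    moreover have "subst_y 1 N = subst_y 1 m * (1 + 1) ^ 2 * F'"
      by (simp add: N_def subst_y_y subst_F)
    moreover have "subst_y 1 m \<noteq> 0"
    proof
      assume "subst_y 1 m = 0"
      moreover have "subst_y 1 m = 2 * q - t * (t * ((1 + 1) * (l0 + (1 + 1) * subst_y 1 l1)))"
        by (simp add: m_def subst_y_y subst_y_q subst_y_t subst_l0)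
      ultimately have "t * (2 * (t * ((1 + 1) * (l0 + (1 + 1) * subst_y 1 l1)))) = 1"
        using q by algebra
      then show False unfolding t_def by (rule notE[OF fps_X_mult_neq_1])
    qed
    ultimately show ?thesis by simp
  qed
  ultimately show ?thesis
    unfolding F_def F'_def by blast
qed

section \<open>Discriminants and elimination\<close>

lemma cubic_discriminant:
  fixes a b c d :: "'a::idom"
  assumes "a ^ 3 + b * a ^ 2 + c * a + d = 0" "3 * a ^ 2 + 2 * b * a + c = 0"
  shows "b ^ 2 * c ^ 2 - 4 * c ^ 3 - 4 * b ^ 3 * d - 27 * d ^ 2 + 18 * b * c * d = 0"
  using assms by algebra

text \<open>For fixed \<open>b\<close> and \<open>d\<close> the discriminant is a cubic polynomial
  in the linear coefficient, with the three distinct roots \<open>c1\<close>, \<open>c2\<close>,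
  \<open>c3\<close>; these are Vieta's formulas, obtained by divided differences.\<close>

lemma three_singular_cubics:
  fixes b d c1 c2 c3 :: "'a::idom"
  assumes disc: "b ^ 2 * c1 ^ 2 - 4 * c1 ^ 3 - 4 * b ^ 3 * d - 27 * d ^ 2 + 18 * b * c1 * d = 0"
    "b ^ 2 * c2 ^ 2 - 4 * c2 ^ 3 - 4 * b ^ 3 * d - 27 * d ^ 2 + 18 * b * c2 * d = 0"
    "b ^ 2 * c3 ^ 2 - 4 * c3 ^ 3 - 4 * b ^ 3 * d - 27 * d ^ 2 + 18 * b * c3 * d = 0"
    and distinct: "c1 \<noteq> c2" "c1 \<noteq> c3" "c2 \<noteq> c3"
  shows "b ^ 2 = 4 * (c1 + c2 + c3)" "18 * b * d = - 4 * (c1 * c2 + c1 * c3 + c2 * c3)"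
    "27 * d ^ 2 + 4 * b ^ 3 * d = - 4 * (c1 * c2 * c3)"
proof -
  have 12: "- 4 * (c1 ^ 2 + c1 * c2 + c2 ^ 2) + b ^ 2 * (c1 + c2) + 18 * b * d = 0"
  proof -
    have "(c1 - c2) * (- 4 * (c1 ^ 2 + c1 * c2 + c2 ^ 2) + b ^ 2 * (c1 + c2) + 18 * b * d) = 0"
      using disc by algebra
    then show ?thesis using distinct by simp
  qed
  have 13: "- 4 * (c1 ^ 2 + c1 * c3 + c3 ^ 2) + b ^ 2 * (c1 + c3) + 18 * b * d = 0"
  proof -
    have "(c1 - c3) * (- 4 * (c1 ^ 2 + c1 * c3 + c3 ^ 2) + b ^ 2 * (c1 + c3) + 18 * b * d) = 0"
      using disc by algebra
    then show ?thesis using distinct by simp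
  qed
  have "(c2 - c3) * (b ^ 2 - 4 * (c1 + c2 + c3)) = 0"
    using 12 13 by algebra
  then show 1: "b ^ 2 = 4 * (c1 + c2 + c3)" using distinct by simp
  show 2: "18 * b * d = - 4 * (c1 * c2 + c1 * c3 + c2 * c3)"
    using 1 12 by algebra
  show "27 * d ^ 2 + 4 * b ^ 3 * d = - 4 * (c1 * c2 * c3)"
    using 1 2 disc(1) by algebra
qed


text \<open>Eliminating \<open>b\<close> and \<open>d\<close> from Vieta's formulas leaves one
  equation for \<open>c\<close>. In terms of \<open>g = 3 * c + e1\<close> it is a monic quartic, as
  \<open>stab_extend\<close> requires.\<close>

lemma three_singular_cubics_quartic:
  fixes b c d z l1 l2 l3 :: "'a::{idom, semiring_char_0}"
  defines "c1 \<equiv> c + l1" and "c2 \<equiv> c + l2" and "c3 \<equiv> c + l3"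
  defines "e1 \<equiv> l1 + l2 + l3" and "e2 \<equiv> l1 * l2 + l1 * l3 + l2 * l3" and "e3 \<equiv> l1 * l2 * l3"
  defines "g \<equiv> c1 + c2 + c3"
  assumes 1: "b ^ 2 = 4 * (c1 + c2 + c3)"
    and 2: "18 * b * d = - 4 * (c1 * c2 + c1 * c3 + c2 * c3)"
    and 3: "27 * d ^ 2 + 4 * b ^ 3 * d = - 4 * (c1 * c2 * c3)"
    and z: "3 * z = 1"
  shows "g ^ 4 = - 2 * (e2 - z * e1 ^ 2) * g ^ 2
    + 4 * (e3 - z * e1 * e2 + 2 * z ^ 3 * e1 ^ 3) * g + z * (e2 - z * e1 ^ 2) ^ 2"
proof -
  define f2 where "f2 = c1 * c2 + c1 * c3 + c2 * c3"
  define f3 where "f3 = c1 * c2 * c3"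
  have b: "b ^ 2 = 4 * g" using 1 by (simp add: g_def)
  have "2 * (9 * (b * d) + 2 * f2) = 0" using 2 unfolding f2_def by algebra
  then have "9 * (b * d) + 2 * f2 = 0" by (metis mult_eq_0_iff zero_neq_numeral)
  then have bd: "9 * (b * d) = - 2 * f2" by algebra
  \<comment> \<open>The square of \<open>bd\<close>, with \<open>b ^ 2\<close> replaced by
    \<open>4 * g\<close>.\<close>
  have "4 * (81 * g * d ^ 2 - f2 ^ 2) = 0" using b bd by algebra
  then have "81 * g * d ^ 2 - f2 ^ 2 = 0" by (metis mult_eq_0_iff zero_neq_numeral)
  then have d2: "81 * g * d ^ 2 = f2 ^ 2" by simp
  have d3: "27 * d ^ 2 + 16 * g * (b * d) = - 4 * f3" using 3 b unfolding f3_def by algebra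
  have "9 * (36 * g * f3 - 32 * g ^ 2 * f2 + 3 * f2 ^ 2) = 0" using bd d2 d3 by algebra
  then have *: "36 * g * f3 - 32 * g ^ 2 * f2 + 3 * f2 ^ 2 = 0" by (metis mult_eq_0_iff zero_neq_numeral)
  \<comment> \<open>\<open>h\<close> and \<open>k\<close> are the second and third elementary
    symmetric functions of the \<open>l1\<close>, \<open>l2\<close>, \<open>l3\<close> shifted by
    their mean; each \<open>c + li\<close> is \<open>g / 3\<close> plus such a shifted
    value.\<close>
  define h where "h = e2 - z * e1 ^ 2"
  define k where "k = e3 - z * e1 * e2 + 2 * z ^ 3 * e1 ^ 3"
  have g: "g = 3 * c + e1" unfolding g_def c1_def c2_def c3_def e1_def by algebra
  have f2: "f2 = z * g ^ 2 + h"
    unfolding f2_def c1_def c2_def c3_def g h_def e2_def e1_def using z by algebra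
  have f3: "f3 = z ^ 3 * g ^ 3 + z * h * g + k"
    unfolding f3_def c1_def c2_def c3_def g h_def k_def e3_def e2_def e1_def using z by algebra
  have "9 * (g ^ 4 - (- 2 * h * g ^ 2 + 4 * k * g + z * h ^ 2)) = 0"
    using * z unfolding f2 f3 by algebra
  then have "g ^ 4 - (- 2 * h * g ^ 2 + 4 * k * g + z * h ^ 2) = 0"
    by (metis mult_eq_0_iff zero_neq_numeral)
  then show ?thesis unfolding h_def k_def by simp
qed

subsection \<open>Algebraicity\<close>

interpretation series: domain_algebra "fps_of_poly :: rat poly poly poly \<Rightarrow> series"
  by unfold_locales (simp_all add: fps_of_poly_add fps_of_poly_mult)

lemma series_of_poly:
  "fps_X = fps_of_poly [:0, 1:]" "varx = fps_of_poly [:[:[:0, 1:]:]:]"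
  "vary = fps_of_poly [:[:0, 1:]:]" "cst r = fps_of_poly [:[:[:r:]:]:]"
  by (simp_all add: varx_def vary_def cst_def fps_of_poly_const)

lemma stab_vars: "fps_X \<in> series.stab B" "varx \<in> series.stab B" "vary \<in> series.stab B" "cst r \<in> series.stab B"
  unfolding series_of_poly by (rule series.stab_base)+

lemma stab_numeral: "numeral n \<in> series.stab B"
  using series.stab_base[of "numeral n" B] by simp

lemmas stab_intros = stab_vars stab_numeral series.stab_zero series.stab_one series.stab_add series.stab_diff
  series.stab_mult series.stab_uminus series.stab_power

lemma kernel_nonzero: "kernel \<noteq> 0"
  using subst_kernel(2) by (metis fps_X_neq_zero neg_equal_0_iff_equal subst_0_1(3))

theorem theorem3: "algebraic_series gessel_gf"
proof -
  define t where "t = (fps_X :: series)"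
  define x where "x = varx"
  define y where "y = vary"
  obtain b c d where free: "\<And>r. subst_x r b = b" "\<And>r. subst_y r b = b"
    "\<And>r. subst_x r c = c" "\<And>r. subst_y r c = c"
    "\<And>r. subst_x r d = d" "\<And>r. subst_y r d = d"
    and inv_x: "inv_x ^ 3 + b * x * inv_x ^ 2 + (c * x ^ 2 + rat_x) * inv_x + d * x ^ 3 = 0"
    and inv_y: "y * inv_y ^ 3 + b * (1 + y) * y * inv_y ^ 2 + c * (1 + y) ^ 2 * y * inv_y
      + rat_y * inv_y + d * y * (1 + y) ^ 3 = 0"
    unfolding x_def y_def using gessel_cubics by blast
  \<comment> \<open>The values of \<open>t^2 I\<close> at \<open>x = 1\<close> and
    \<open>x = -1\<close>, then of \<open>t^2 J\<close> at \<open>y = 1\<close>.\<close>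
  define l1 where "l1 = 2 * t - 4 * t ^ 2"
  define l2 where "l2 = - 2 * t - 4 * t ^ 2"
  define l3 where "l3 = cst (1 / 4)"
  have l3: "4 * l3 = 1" unfolding l3_def by (rule cst_mult_numeral) simp
  have disc: "b ^ 2 * (c + l) ^ 2 - 4 * (c + l) ^ 3 - 4 * b ^ 3 * d - 27 * d ^ 2 + 18 * b * (c + l) * d = 0"
    if "l \<in> {l1, l2, l3}" for l
    using x_double_root[of 1 b c d] x_double_root[of "- 1" b c d] y_double_root[of b c d]
      free inv_x inv_y that cubic_discriminant[of _ b "c + l" d]
    unfolding x_def y_def by (auto simp: l1_def l2_def l3_def t_def add_diff_eq)
  have "c + l1 \<noteq> c + l2"
    by (simp add: l1_def l2_def t_def)
  moreover have "c + l1 \<noteq> c + l3"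
  proof
    assume "c + l1 = c + l3"
    then have "t * (8 - 16 * t) = 1" using l3 unfolding l1_def by algebra
    then show False unfolding t_def by (rule notE[OF fps_X_mult_neq_1])
  qed
  moreover have "c + l2 \<noteq> c + l3"
  proof
    assume "c + l2 = c + l3"
    then have "t * (- 8 - 16 * t) = 1" using l3 unfolding l2_def by algebra
    then show False unfolding t_def by (rule notE[OF fps_X_mult_neq_1])
  qed
  ultimately have
    b: "b ^ 2 = 4 * (c + l1 + (c + l2) + (c + l3))" and
    bd: "18 * b * d = - 4 * ((c + l1) * (c + l2) + (c + l1) * (c + l3) + (c + l2) * (c + l3))" and
    d: "27 * d ^ 2 + 4 * b ^ 3 * d = - 4 * ((c + l1) * (c + l2) * (c + l3))"
    using three_singular_cubics[of b "c + l1" d "c + l2" "c + l3"] disc by blast+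
  define g where "g = c + l1 + (c + l2) + (c + l3)"
  define z where "z = cst (1 / 3)"
  have z: "3 * z = 1" unfolding z_def by (rule cst_mult_numeral) simp
  define e1 where "e1 = l1 + l2 + l3"
  define e2 where "e2 = l1 * l2 + l1 * l3 + l2 * l3"
  define e3 where "e3 = l1 * l2 * l3"
  have g: "g ^ 4 = - 2 * (e2 - z * e1 ^ 2) * g ^ 2
      + 4 * (e3 - z * e1 * e2 + 2 * z ^ 3 * e1 ^ 3) * g + z * (e2 - z * e1 ^ 2) ^ 2"
    unfolding g_def e1_def e2_def e3_def by (rule three_singular_cubics_quartic[OF b bd d z])
  have stab_l: "l1 \<in> series.stab B" "l2 \<in> series.stab B" "l3 \<in> series.stab B" "z \<in> series.stab B"
    "x \<in> series.stab B" "y \<in> series.stab B" "t \<in> series.stab B" "rat_x \<in> series.stab B" "rat_y \<in> series.stab B" for B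
    unfolding l1_def l2_def l3_def z_def t_def x_def y_def rat_x_def rat_y_def
    by (intro stab_intros)+
  have stab_e: "e1 \<in> series.stab B" "e2 \<in> series.stab B" "e3 \<in> series.stab B" for B
    unfolding e1_def e2_def e3_def by (intro stab_intros stab_l)+

  \<comment> \<open>A tower starts here from \<open>{1}\<close>: \<open>g\<close>, \<open>b\<close>,
    \<open>d\<close>, \<open>inv_x\<close> and \<open>y * inv_y\<close> are adjoined in turn, each
    by a monic equation over what is already available.\<close>
  have "\<exists>B. finite B \<and> 1 \<in> B \<and> series.stab {1} \<subseteq> series.stab B \<and> g \<in> series.stab B"
    by (rule series.stab_extend[of _ "[z * (e2 - z * e1 ^ 2) ^ 2,
        4 * (e3 - z * e1 * e2 + 2 * z ^ 3 * e1 ^ 3), - 2 * (e2 - z * e1 ^ 2), 0]"])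
       (use g in \<open>auto simp: eval_nat_numeral algebra_simps simp del: mult_Suc mult_Suc_right intro!: stab_intros stab_l stab_e\<close>)
  then obtain B1 where B1: "finite B1" "1 \<in> B1" "g \<in> series.stab B1" by blast
  have b_eq: "b ^ 2 = 4 * g" using b by (simp add: g_def)
  have "\<exists>B. finite B \<and> 1 \<in> B \<and> series.stab B1 \<subseteq> series.stab B \<and> b \<in> series.stab B"
    by (rule series.stab_extend[OF B1(1,2), of "[4 * g, 0]"])
       (auto simp: b_eq power2_eq_square[symmetric] intro!: stab_intros B1)
  then obtain B2 where B2: "finite B2" "1 \<in> B2" "g \<in> series.stab B2" "b \<in> series.stab B2"
    using B1 by blast
  have "c = z * (g - e1)"
    using z unfolding g_def e1_def by algebra
  then have c2: "c \<in> series.stab B2"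
    using B2 by (auto intro!: stab_intros stab_l stab_e)
  have d_eq: "d ^ 2 = - 4 * z ^ 3 * ((c + l1) * (c + l2) * (c + l3)) + - 4 * z ^ 3 * b ^ 3 * d"
    using d z by algebra
  have "\<exists>B. finite B \<and> 1 \<in> B \<and> series.stab B2 \<subseteq> series.stab B \<and> d \<in> series.stab B"
    by (rule series.stab_extend[OF B2(1,2),
        of "[- 4 * z ^ 3 * ((c + l1) * (c + l2) * (c + l3)), - 4 * z ^ 3 * b ^ 3]"])
       (auto simp: d_eq power2_eq_square[symmetric] intro!: stab_intros stab_l B2 c2)
  then obtain B3 where B3: "finite B3" "1 \<in> B3" "b \<in> series.stab B3" "c \<in> series.stab B3" "d \<in> series.stab B3"
    using B2 c2 by blast
  have w_eq: "inv_x ^ 3 = - (d * x ^ 3) + - (c * x ^ 2 + rat_x) * inv_x + - (b * x) * inv_x ^ 2"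
    using inv_x by algebra
  have "\<exists>B. finite B \<and> 1 \<in> B \<and> series.stab B3 \<subseteq> series.stab B \<and> inv_x \<in> series.stab B"
    by (rule series.stab_extend[OF B3(1,2), of "[- (d * x ^ 3), - (c * x ^ 2 + rat_x), - (b * x)]"])
       (use w_eq in \<open>auto simp: eval_nat_numeral intro!: stab_intros stab_l B3\<close>)
  then obtain B4 where B4: "finite B4" "1 \<in> B4" "b \<in> series.stab B4" "c \<in> series.stab B4" "d \<in> series.stab B4"
    "inv_x \<in> series.stab B4"
    using B3 by blast
  \<comment> \<open>The cubic for \<open>inv_y\<close> has leading coefficient \<open>y\<close>;
    multiplied by \<open>y ^ 2\<close> it is monic in \<open>y * inv_y\<close>.\<close>
  have v_eq: "(y * inv_y) ^ 3 = - (d * y ^ 3 * (1 + y) ^ 3)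
      + - (c * (1 + y) ^ 2 * y ^ 2 + rat_y * y) * (y * inv_y) + - (b * (1 + y) * y) * (y * inv_y) ^ 2"
    using inv_y by algebra
  have "\<exists>B. finite B \<and> 1 \<in> B \<and> series.stab B4 \<subseteq> series.stab B \<and> y * inv_y \<in> series.stab B"
    by (rule series.stab_extend[OF B4(1,2), of "[- (d * y ^ 3 * (1 + y) ^ 3),
        - (c * (1 + y) ^ 2 * y ^ 2 + rat_y * y), - (b * (1 + y) * y)]"])
       (use v_eq in \<open>auto simp: eval_nat_numeral intro!: stab_intros stab_l B4\<close>)
  then obtain B where B: "finite B" "1 \<in> B" "inv_x \<in> series.stab B" "y * inv_y \<in> series.stab B"
    using B4 by blast

  \<comment> \<open>The kernel times the factors that turn \<open>bottom\<close> and
    \<open>left\<close> into \<open>inv_x\<close> and \<open>inv_y\<close>, with one more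
    \<open>y\<close> because only \<open>y * inv_y\<close> was adjoined.\<close>
  define D where "D = t * x * y * (1 + y) * (x * y - t * (1 + y) * (x ^ 2 * y + 1))"
  have "D * gessel_gf = t * x ^ 2 * y ^ 2 * (1 + y) - y * (1 + y) * (inv_x - t) + x * (y * inv_y - y ^ 2)"
    using kernel_gessel_gf
    unfolding D_def inv_x_def inv_y_def kernel_def x_def[symmetric] y_def[symmetric] t_def[symmetric]
    by algebra
  then have DG: "D * gessel_gf \<in> series.stab B"
    using B by (auto intro!: stab_intros stab_l)
  define D' :: "rat poly poly poly" where "D' = (let t = [:0, 1:]; x = [:[:[:0, 1:]:]:]; y = [:[:0, 1:]:]
    in t * x * y * (1 + y) * (x * y - t * (1 + y) * (x ^ 2 * y + 1)))"
  have D': "D = fps_of_poly D'"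
    by (simp only: D_def D'_def Let_def x_def y_def t_def series_of_poly fps_of_poly_mult
        fps_of_poly_add fps_of_poly_diff fps_of_poly_power fps_of_poly_1)
  have "D \<noteq> 0"
    using kernel_nonzero var_nonzero nonzero_1_plus_vary unfolding D_def kernel_def x_def y_def t_def by simp
  then have "D' \<noteq> 0" using D' by auto
  moreover obtain p where "p \<noteq> 0" "poly (map_poly fps_of_poly p) (fps_of_poly D' * gessel_gf) = 0"
    using series.stab_algebraic[OF B(1,2) DG] unfolding D' by blast
  ultimately show ?thesis
    unfolding algebraic_series_def subst_series_def by (rule series.algebraic_of_scaled)
qed

end
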